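(* Let $1\le m<n$ be integers, let $T$ be a real $(n\times m)$-matrix of full rank $m$ such that $\frac{1}{n\nu_n}\int_{S^{n-1}}\|T^t\eta\|^2\,d\eta=1$, let $s$ be a real number, and let $U$ be the solution of $\mathcal{L}U=F$, that is, $\widehat{U}(\omega)=\widehat{F}(\omega)/\|T^t\omega\|^2$. For polynomials $P_k$ of order $k$ with $P_k(0)=1$, let the iterates $U_k$ be given by $$(\widehat{U}-\widehat{U}_k)(r\eta)=P_k\big(\|T^t\eta\|^2\big)\,\widehat{U}(r\eta),\quad r>0,\ \eta\in S^{n-1}.$$ Under the assumption that the norm $|\!|\!|U|\!|\!|_s$ of the solution $U$ takes a finite value, the iteration error can be estimated as $$\|U-U_k\|_s^2\leq\int_{-\infty}^\infty P_k(t)^2 f(t)\,dt\;\,|\!|\!|U|\!|\!|_s^2$$ in terms of the density $f$ of the distribution of the values $\|T^t\eta\|^2$ on the unit sphere $S^{n-1}$.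
   Context: $\|\cdot\|$ (on vectors) is the Euclidean norm, $T^t$ the transpose of $T$, $S^{n-1}$ the unit sphere of $\mathbb{R}^n$ with surface measure $d\eta$, $\nu_n$ the volume of the unit ball of $\mathbb{R}^n$. A polynomial of order $k$ is a real polynomial of degree at most $k$. All functions $U:\mathbb{R}^n\to\mathbb{R}$ considered possess the representation $U(y)=(2\pi)^{-n/2}\int\widehat{U}(\omega)e^{i\omega\cdot y}\,d\omega$ with an integrable function $\widehat{U}$, their Fourier transform. $\mathcal{L}$ is the operator given by $(\mathcal{L}U)(y)=(2\pi)^{-n/2}\int\|T^t\omega\|^2\widehat{U}(\omega)e^{i\omega\cdot y}\,d\omega$. The right-hand side $F$ has an integrable Fourier transform $\widehat{F}$, and $\omega\mapsto\widehat{F}(\omega)/\|T^t\omega\|^2$ is assumed to be integrable. For real $s$, with $\phi(\eta)=n\nu_n\int_0^\infty\|T^t\eta\|^s\,|\widehat{U}(r\eta)|\,r^{s+n-1}\,dr$ for $\eta\in S^{n-1}$, the norms are $\|U\|_s=\frac{1}{n\nu_n}\int_{S^{n-1}}\phi(\eta)\,d\eta$ (equivalently $\int_{\mathbb{R}^n}\|T^t\omega\|^s|\widehat{U}(\omega)|\,d\omega$) and $|\!|\!|U|\!|\!|_s^2=\frac{1}{n\nu_n}\int_{S^{n-1}}\phi(\eta)^2\,d\eta$. The density $f$ is the nonnegative function on $\mathbb{R}$ with $\frac{1}{n\nu_n}\,\mathrm{area}\{\eta\in S^{n-1}\mid\|T^t\eta\|^2\leq\delta\}=\int_{-\infty}^\delta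 f(t)\,dt$ for all $\delta$. *)

theory Defs
  imports "HOL-Analysis.Analysis"
begin

text \<open>The surface measure on the unit sphere is obtained from Lebesgue measure in the usual way:
  the surface measure of a Borel set \<open>A\<close> of unit vectors is \<open>n\<close> times the volume of
  the part of the cone over \<open>A\<close> inside the unit ball.\<close>

definition surface_measure :: "'a::euclidean_space measure" where
  "surface_measure =
     scale_measure (of_nat DIM('a))
       (distr (restrict_space lborel (ball 0 1 - {0})) (restrict_space borel (sphere 0 1)) sgn)"

definition sphere_area :: "nat \<Rightarrow> real" where
  "sphere_area n = real n * unit_ball_vol (real n)"

lemma space_surface_measure [simp]:
  "space (surface_measure :: 'a::euclidean_space measure) = sphere 0 1"
  by (simp add: surface_measure_def space_scale_measure space_restrict_space)

lemma sets_surface_measure [simp, measurable_cong]: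
  "sets (surface_measure :: 'a::euclidean_space measure) = sets (restrict_space borel (sphere 0 1))"
  by (simp add: surface_measure_def)

lemma emeasure_surface_measure:
  fixes A :: "'a::euclidean_space set"
  assumes "A \<in> sets borel" "A \<subseteq> sphere 0 1"
  shows "emeasure surface_measure A =
           of_nat DIM('a) * emeasure lborel {x. 0 < norm x \<and> norm x < 1 \<and> sgn x \<in> A}"
proof -
  have m: "sgn \<in> restrict_space lborel (ball 0 1 - {0}) \<rightarrow>\<^sub>M
                   restrict_space borel (sphere (0::'a) 1)"
  proof (rule measurable_restrict_space2)
    show "sgn \<in> space (restrict_space lborel (ball 0 1 - {0})) \<rightarrow> sphere (0::'a) 1"
      by (auto simp add: norm_sgn space_restrict_space)
    have "continuous_on (ball 0 1 - {0}) (sgn :: 'a \<Rightarrow> 'a)"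
      unfolding sgn_div_norm by (intro continuous_intros) auto
    then have "sgn \<in> restrict_space borel (ball 0 1 - {0}) \<rightarrow>\<^sub>M (borel :: 'a measure)"
      by (rule borel_measurable_continuous_on_restrict)
    then show "sgn \<in> restrict_space lborel (ball 0 1 - {0}) \<rightarrow>\<^sub>M (borel :: 'a measure)"
      by (subst measurable_cong_sets[OF sets_restrict_space_cong[OF sets_lborel] refl])
  qed
  have A: "A \<in> sets (restrict_space borel (sphere 0 1))"
    using assms by (auto simp: sets_restrict_space)
  have eq: "sgn -` A \<inter> (ball 0 1 - {0}) = {x. 0 < norm x \<and> norm x < 1 \<and> sgn x \<in> A}"
    by auto
  have "emeasure (distr (restrict_space lborel (ball 0 1 - {0}))
            (restrict_space borel (sphere 0 1)) sgn) A
          = emeasure (restrict_space lborel (ball 0 1 - {0})) (sgn -` A \<inter> (ball 0 1 - {0}))"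
    using emeasure_distr[OF m A] by (simp only: space_restrict_space space_lborel space_borel Int_UNIV_right)
  also have "\<dots> = emeasure lborel (sgn -` A \<inter> (ball 0 1 - {0}))"
    by (rule emeasure_restrict_space) auto
  finally show ?thesis
    unfolding surface_measure_def emeasure_scale_measure eq by simp
qed

lemma emeasure_surface_measure_sphere:
  "emeasure (surface_measure :: 'a::euclidean_space measure) (sphere 0 1) =
     ennreal (sphere_area DIM('a))"
proof -
  have "{x::'a. 0 < norm x \<and> norm x < 1 \<and> sgn x \<in> sphere 0 1} = ball 0 1 - {0}"
    by (auto simp: norm_sgn)
  moreover have "emeasure lborel (ball (0::'a) 1 - {0}) = emeasure lborel (ball (0::'a) 1)"
    by (rule emeasure_Diff_null_set) auto
  moreover have "sphere (0::'a) 1 \<in> sets borel"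
    by (intro borel_closed closed_sphere)
  ultimately have "emeasure (surface_measure :: 'a measure) (sphere 0 1) =
      of_nat DIM('a) * emeasure lborel (ball (0::'a) 1)"
    using emeasure_surface_measure[of "sphere (0::'a) 1"] by simp
  then show ?thesis
    by (simp add: emeasure_ball sphere_area_def ennreal_mult ennreal_of_nat_eq_real_of_nat)
qed

text \<open>\<open>has_fourier_transform U V\<close> is the representation
  $U(y) = (2\pi)^{-n/2} \int V(\omega) e^{i \omega \cdot y} \, d\omega$ of a real-valued function
  \<open>U\<close> with an integrable \<open>V\<close>. It determines \<open>V\<close> up to a null set. The notions depending
  on the transform alone take \<open>V\<close> as their argument; below \<open>V\<close> always stands for a transform.\<close>

definition inv_fourier :: "(real^'n \<Rightarrow> complex) \<Rightarrow> real^'n \<Rightarrow> complex" where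
  "inv_fourier V y =
     complex_of_real ((2 * pi) powr (- real CARD('n) / 2)) *
       (\<integral>\<omega>. V \<omega> * exp (\<i> * complex_of_real (\<omega> \<bullet> y)) \<partial>lborel)"

definition has_fourier_transform :: "(real^'n \<Rightarrow> real) \<Rightarrow> (real^'n \<Rightarrow> complex) \<Rightarrow> bool" where
  "has_fourier_transform U V \<longleftrightarrow>
     integrable lborel V \<and> (\<forall>y. complex_of_real (U y) = inv_fourier V y)"

definition L_op :: "real^'m^'n \<Rightarrow> (real^'n \<Rightarrow> complex) \<Rightarrow> real^'n \<Rightarrow> complex" where
  "L_op T V = inv_fourier (\<lambda>\<omega>. complex_of_real ((norm (transpose T *v \<omega>))\<^sup>2) * V \<omega>)"

text \<open>The norms may be infinite and are therefore extended nonnegative numbers. The convention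
  \<open>0 powr s = 0\<close> only matters for \<open>\<eta>\<close> in the kernel of
  \<open>transpose T\<close>, which meets the sphere in a null set when \<open>T \<noteq> 0\<close>.\<close>

definition radial_part ::
  "real^'m^'n \<Rightarrow> real \<Rightarrow> (real^'n \<Rightarrow> complex) \<Rightarrow> real^'n \<Rightarrow> ennreal" where
  "radial_part T s V \<eta> =
     ennreal (sphere_area CARD('n)) *
       (\<integral>\<^sup>+r\<in>{0<..}. ennreal (norm (transpose T *v \<eta>) powr s * cmod (V (r *\<^sub>R \<eta>)) *
                           r powr (s + real CARD('n) - 1)) \<partial>lborel)"

definition s_norm :: "real^'m^'n \<Rightarrow> real \<Rightarrow> (real^'n \<Rightarrow> complex) \<Rightarrow> ennreal" where
  "s_norm T s V =
     (\<integral>\<^sup>+\<eta>. radial_part T s V \<eta> \<partial>surface_measure) / ennreal (sphere_area CARD('n))"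

definition ennsqrt :: "ennreal \<Rightarrow> ennreal" where
  "ennsqrt x = (if x = \<infinity> then \<infinity> else ennreal (sqrt (enn2real x)))"

lemma ennsqrt_power2 [simp]: "(ennsqrt x)\<^sup>2 = x"
proof (cases x)
  case (real r)
  then show ?thesis by (simp add: ennsqrt_def ennreal_power)
next
  case top
  then show ?thesis by (simp add: ennsqrt_def power2_eq_square)
qed

definition triple_norm :: "real^'m^'n \<Rightarrow> real \<Rightarrow> (real^'n \<Rightarrow> complex) \<Rightarrow> ennreal" where
  "triple_norm T s V =
     ennsqrt ((\<integral>\<^sup>+\<eta>. (radial_part T s V \<eta>)\<^sup>2 \<partial>surface_measure) / ennreal (sphere_area CARD('n)))"

definition is_sphere_density :: "real^'m^'n \<Rightarrow> (real \<Rightarrow> real) \<Rightarrow> bool" where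
  "is_sphere_density T f \<longleftrightarrow>
     f \<in> borel_measurable borel \<and> (\<forall>t. 0 \<le> f t) \<and>
     (\<forall>\<delta>. set_integrable lborel {..\<delta>} f \<and>
          measure surface_measure {\<eta> \<in> sphere 0 1. (norm (transpose T *v \<eta>))\<^sup>2 \<le> \<delta>}
              / sphere_area CARD('n)
            = (LINT t:{..\<delta>}|lborel. f t))"

end

theory Submission
  imports Defs
begin

text \<open>Along each ray the error is the solution scaled by the constant
  \<open>P\<^sub>k(\<parallel>T\<^sup>t \<eta>\<parallel>\<^sup>2)\<close>, so the radial part \<open>\<phi>\<close> of the error is
  \<open>\<bar>P\<^sub>k(\<parallel>T\<^sup>t \<eta>\<parallel>\<^sup>2)\<bar> \<phi>(\<eta>)\<close>. The Cauchy-Schwarz inequality on the sphere separates the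
  two factors, and the image of the surface measure under \<open>\<eta> \<mapsto> \<parallel>T\<^sup>t \<eta>\<parallel>\<^sup>2\<close> has density \<open>f\<close>
  up to normalization, which turns the integral of the first factor into
  \<open>\<integral> P\<^sub>k(t)\<^sup>2 f(t) dt\<close>.\<close>

text \<open>Uniqueness of measures: the closed half-lines are stable under intersection, generate
  the Borel sets and exhaust the line by sets of finite measure. This suits the density
  \<open>f\<close>, which is given only through its distribution function.\<close>

lemma measure_eqI_atMost:
  fixes M N :: "real measure"
  assumes "sets M = sets borel" "sets N = sets borel"
    and "\<And>x. emeasure M {..x} < \<infinity>"
    and "\<And>x. emeasure M {..x} = emeasure N {..x}"
  shows "M = N"
proof (rule measure_eqI_generator_eq)
  show "Int_stable (range atMost :: real set set)"
    by (auto simp: Int_stable_def)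
  show "sets M = sigma_sets UNIV (range atMost)" "sets N = sigma_sets UNIV (range atMost)"
    using assms(1,2) unfolding borel_eq_atMost by simp_all
  show "(\<Union>i::nat. {..real i}) = UNIV"
    using real_arch_simple by auto
  show "emeasure M {..real i} \<noteq> \<infinity>" for i :: nat
    using assms(3)[of "real i"] by simp
qed (use assms(4) in auto)

lemma sphere_area_pos: "0 < n \<Longrightarrow> 0 < sphere_area n"
  by (simp add: sphere_area_def)

lemma finite_measure_surface_measure:
  "finite_measure (surface_measure :: 'a::euclidean_space measure)"
  by (rule finite_measureI) (simp add: emeasure_surface_measure_sphere)

lemma borel_measurable_surface_measure:
  "g \<in> borel_measurable borel \<Longrightarrow> g \<in> borel_measurable surface_measure"
  by (simp add: measurable_cong_sets[OF sets_surface_measure refl] measurable_restrict_space1)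

lemma continuous_on_norm_transpose:
  fixes T :: "real^'m^'n"
  shows "continuous_on A (\<lambda>\<eta>. norm (transpose T *v \<eta>))"
  by (intro continuous_intros linear_continuous_on matrix_vector_mul_bounded_linear)

lemma borel_measurable_norm_transpose [measurable]:
  fixes T :: "real^'m^'n"
  shows "(\<lambda>\<eta>. norm (transpose T *v \<eta>)) \<in> borel_measurable borel"
  by (intro borel_measurable_continuous_onI continuous_on_norm_transpose)

lemma borel_measurable_poly [measurable]:
  fixes p :: "real poly"
  shows "poly p \<in> borel_measurable borel"
  by (intro borel_measurable_continuous_onI continuous_intros)

lemma borel_measurable_radial_part:
  assumes [measurable]: "V \<in> borel_measurable borel"
  shows "radial_part T s V \<in> borel_measurable borel"
  unfolding radial_part_def[abs_def] by measurable

text \<open>For a fixed direction \<open>c\<close> does not vary with \<open>r\<close>, so by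
  multiplicativity of \<open>cmod\<close> it leaves the radial integral. Almost every
  \<open>r\<close> suffices, in keeping with transforms that are determined only up to null
  sets.\<close>

lemma radial_part_cmult:
  fixes T :: "real^'m^'n"
  assumes [measurable]: "V \<in> borel_measurable borel"
    and ae: "AE r in lborel. 0 < r \<longrightarrow> W (r *\<^sub>R \<eta>) = c * V (r *\<^sub>R \<eta>)"
  shows "radial_part T s W \<eta> = ennreal (cmod c) * radial_part T s V \<eta>"
proof -
  let ?h = "\<lambda>V r. ennreal (norm (transpose T *v \<eta>) powr s * cmod (V (r *\<^sub>R \<eta>)) *
                           r powr (s + real CARD('n) - 1)) * indicator {0<..} r"
  have "(\<integral>\<^sup>+r. ?h W r \<partial>lborel) = (\<integral>\<^sup>+r. ennreal (cmod c) * ?h V r \<partial>lborel)"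
    using ae by (intro nn_integral_cong_AE)
      (auto elim!: eventually_mono simp: norm_mult ennreal_mult'[symmetric] mult_ac split: split_indicator)
  also have "\<dots> = ennreal (cmod c) * (\<integral>\<^sup>+r. ?h V r \<partial>lborel)"
    by (intro nn_integral_cmult) measurable
  finally show ?thesis
    by (simp add: radial_part_def mult_ac)
qed

text \<open>Both sides have the same finite values on all half-lines \<open>{..x}\<close>, by the
  defining property of \<open>f\<close>. The factor \<open>sphere_area\<close> undoes the
  normalization there.\<close>

lemma distr_surface_measure_eq_density:
  fixes T :: "real^'m^'n"
  assumes "is_sphere_density T f"
  shows "distr surface_measure borel (\<lambda>\<eta>. (norm (transpose T *v \<eta>))\<^sup>2) =
           density lborel (\<lambda>t. ennreal (sphere_area CARD('n) * f t))"
    (is "distr _ _ ?q = density _ (\<lambda>t. ennreal (?A * f t))")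
proof (rule measure_eqI_atMost)
  have f [measurable]: "f \<in> borel_measurable borel" and f0: "\<And>t. 0 \<le> f t"
    and int: "\<And>\<delta>. set_integrable lborel {..\<delta>} f"
    and f_eq: "\<And>\<delta>. measure surface_measure {\<eta> \<in> sphere 0 1. ?q \<eta> \<le> \<delta>} / ?A
                    = (LINT t:{..\<delta>}|lborel. f t)"
    using assms by (auto simp: is_sphere_density_def)
  interpret S: finite_measure "surface_measure :: (real^'n) measure"
    by (rule finite_measure_surface_measure)
  have A: "0 < ?A" by (intro sphere_area_pos) simp
  have q: "?q \<in> borel_measurable surface_measure"
    by (rule borel_measurable_surface_measure) measurable
  \<comment> \<open>The surface measure is finite, so the extended value is the real number
    \<open>measure\<close> that occurs in the definition of the density.\<close>
  have d: "emeasure (distr surface_measure borel ?q) {..x} =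
             ennreal (measure surface_measure {\<eta> \<in> sphere 0 1. ?q \<eta> \<le> x})" for x
    by (subst emeasure_distr[OF q])
      (auto simp: S.emeasure_eq_measure intro!: arg_cong[where f = "measure surface_measure"])
  then show "emeasure (distr surface_measure borel ?q) {..x} < \<infinity>" for x
    by simp
  show "emeasure (distr surface_measure borel ?q) {..x} =
          emeasure (density lborel (\<lambda>t. ennreal (?A * f t))) {..x}" for x
  proof -
    have "emeasure (density lborel (\<lambda>t. ennreal (?A * f t))) {..x} =
            (\<integral>\<^sup>+t. ennreal (?A * (indicator {..x} t * f t)) \<partial>lborel)"
      by (subst emeasure_density) (auto intro!: nn_integral_cong split: split_indicator)
    \<comment> \<open>Integrability of \<open>f\<close> on each half-line permits the passage to the
      real integral.\<close>
    also have "\<dots> = ennreal (\<integral>t. ?A * (indicator {..x} t * f t) \<partial>lborel)"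
      using int[of x] f0 A
      by (intro nn_integral_eq_integral) (auto simp: set_integrable_def)
    also have "\<dots> = ennreal (?A * (LINT t:{..x}|lborel. f t))"
      by (simp add: set_lebesgue_integral_def)
    also have "\<dots> = emeasure (distr surface_measure borel ?q) {..x}"
      unfolding d using A by (simp only: f_eq[symmetric]) simp
    finally show ?thesis by simp
  qed
qed simp_all

text \<open>Change of variables to the image measure on the line. With extended nonnegative
  \<open>g\<close> it holds without any question of convergence.\<close>

lemma nn_integral_sphere_density:
  fixes T :: "real^'m^'n"
  assumes f: "is_sphere_density T f"
    and [measurable]: "g \<in> borel_measurable borel"
  shows "(\<integral>\<^sup>+\<eta>. g ((norm (transpose T *v \<eta>))\<^sup>2) \<partial>surface_measure) =
           ennreal (sphere_area CARD('n)) * (\<integral>\<^sup>+t. ennreal (f t) * g t \<partial>lborel)"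
proof -
  have [measurable]: "f \<in> borel_measurable borel" and f0: "\<And>t. 0 \<le> f t"
    using f by (auto simp: is_sphere_density_def)
  have q: "(\<lambda>\<eta>. (norm (transpose T *v \<eta>))\<^sup>2) \<in> borel_measurable surface_measure"
    by (rule borel_measurable_surface_measure) measurable
  have "(\<integral>\<^sup>+\<eta>. g ((norm (transpose T *v \<eta>))\<^sup>2) \<partial>surface_measure) =
          (\<integral>\<^sup>+t. ennreal (sphere_area CARD('n) * f t) * g t \<partial>lborel)"
    by (subst nn_integral_distr[OF q, symmetric], simp,
        subst distr_surface_measure_eq_density[OF f], subst nn_integral_density) simp_all
  also have "\<dots> = (\<integral>\<^sup>+t. ennreal (sphere_area CARD('n)) * (ennreal (f t) * g t) \<partial>lborel)"
    using f0 by (simp add: ennreal_mult'' mult.assoc)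
  finally show ?thesis
    by (simp add: nn_integral_cmult)
qed

text \<open>The sphere is compact, so \<open>h\<close> is bounded on it, and the total surface
  measure is finite.\<close>

lemma nn_integral_continuous_surface_measure_finite:
  fixes h :: "'a::euclidean_space \<Rightarrow> real"
  assumes "continuous_on (sphere 0 1) h"
  shows "(\<integral>\<^sup>+\<eta>. ennreal (h \<eta>) \<partial>surface_measure) < \<infinity>"
proof -
  have "bounded (h ` sphere 0 1)"
    by (intro compact_imp_bounded compact_continuous_image assms compact_sphere)
  then obtain B where B: "\<And>\<eta>. \<eta> \<in> sphere 0 1 \<Longrightarrow> \<bar>h \<eta>\<bar> \<le> B"
    unfolding bounded_iff real_norm_def by blast
  have "(\<integral>\<^sup>+\<eta>. ennreal (h \<eta>) \<partial>surface_measure) \<le> (\<integral>\<^sup>+\<eta>. ennreal B \<partial>(surface_measure :: 'a measure))"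
    using B by (intro nn_integral_mono ennreal_leI) (auto simp: abs_le_iff)
  also have "\<dots> < \<infinity>"
    by (simp add: emeasure_surface_measure_sphere ennreal_mult_less_top)
  finally show ?thesis .
qed

text \<open>A real integral takes the default value 0 where integrability fails, so integrability of
  \<open>(poly p t)\<^sup>2 * f t\<close> must be established. It is pulled back to the sphere,
  where the integrand is continuous.\<close>

lemma nn_integral_poly_sphere_density:
  fixes T :: "real^'m^'n"
  assumes f: "is_sphere_density T f"
  shows "(\<integral>\<^sup>+\<eta>. (ennreal \<bar>poly p ((norm (transpose T *v \<eta>))\<^sup>2)\<bar>)\<^sup>2 \<partial>surface_measure) =
           ennreal (sphere_area CARD('n)) * ennreal (\<integral>t. (poly p t)\<^sup>2 * f t \<partial>lborel)"
proof -
  have [measurable]: "f \<in> borel_measurable borel" and f0: "\<And>t. 0 \<le> f t"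
    using f by (auto simp: is_sphere_density_def)
  have A: "0 < sphere_area CARD('n)" by (intro sphere_area_pos) simp
  have eq: "(\<integral>\<^sup>+\<eta>. ennreal ((poly p ((norm (transpose T *v \<eta>))\<^sup>2))\<^sup>2) \<partial>surface_measure) =
           ennreal (sphere_area CARD('n)) * (\<integral>\<^sup>+t. ennreal ((poly p t)\<^sup>2 * f t) \<partial>lborel)"
    using f0 nn_integral_sphere_density[OF f, of "\<lambda>t. ennreal ((poly p t)\<^sup>2)"]
    by (simp add: ennreal_mult mult.commute)
  have "(\<integral>\<^sup>+\<eta>. ennreal ((poly p ((norm (transpose T *v \<eta>))\<^sup>2))\<^sup>2) \<partial>surface_measure) < \<infinity>"
    by (intro nn_integral_continuous_surface_measure_finite continuous_intros
        continuous_on_norm_transpose)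
  \<comment> \<open>As the sphere area is positive, finiteness of the product forces finiteness of
    the second factor.\<close>
  with eq A have "(\<integral>\<^sup>+t. ennreal ((poly p t)\<^sup>2 * f t) \<partial>lborel) < \<infinity>"
    by (auto simp: ennreal_mult_less_top)
  then have "integrable lborel (\<lambda>t. (poly p t)\<^sup>2 * f t)"
    using f0 by (intro integrableI_nonneg) auto
  then have "(\<integral>\<^sup>+t. ennreal ((poly p t)\<^sup>2 * f t) \<partial>lborel) = ennreal (\<integral>t. (poly p t)\<^sup>2 * f t \<partial>lborel)"
    using f0 by (intro nn_integral_eq_integral) auto
  with eq show ?thesis
    by (simp add: ennreal_power)
qed

theorem theorem4p4:
  fixes T :: "real^'m^'n" and s :: real
    and U F Uk :: "real^'n \<Rightarrow> real" and Uh Fh Ukh :: "real^'n \<Rightarrow> complex"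
    and k :: nat and Pk :: "real poly" and f :: "real \<Rightarrow> real"
  assumes "CARD('m) < CARD('n)"
    and "rank T = CARD('m)"
    and "(\<integral>\<eta>. (norm (transpose T *v \<eta>))\<^sup>2 \<partial>surface_measure) / sphere_area CARD('n) = 1"
    and "has_fourier_transform U Uh"
    and "has_fourier_transform F Fh"
    and "integrable lborel (\<lambda>\<omega>. Fh \<omega> / complex_of_real ((norm (transpose T *v \<omega>))\<^sup>2))"
    and "\<And>y. L_op T Uh y = complex_of_real (F y)"
    and "AE \<omega> in lborel. Uh \<omega> = Fh \<omega> / complex_of_real ((norm (transpose T *v \<omega>))\<^sup>2)"
    and "degree Pk \<le> k"
    and "poly Pk 0 = 1"
    and "has_fourier_transform Uk Ukh"
    and "AE \<eta> in surface_measure. AE r in lborel. 0 < r \<longrightarrow>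
           Uh (r *\<^sub>R \<eta>) - Ukh (r *\<^sub>R \<eta>) =
             complex_of_real (poly Pk ((norm (transpose T *v \<eta>))\<^sup>2)) * Uh (r *\<^sub>R \<eta>)"
    and "is_sphere_density T f"
    and "triple_norm T s Uh < \<infinity>"
  shows "(s_norm T s (\<lambda>\<omega>. Uh \<omega> - Ukh \<omega>))\<^sup>2
           \<le> ennreal (\<integral>t. (poly Pk t)\<^sup>2 * f t \<partial>lborel) * (triple_norm T s Uh)\<^sup>2"
proof -
  let ?A = "ennreal (sphere_area CARD('n))"
  let ?S = "surface_measure :: (real^'n) measure"
  let ?p = "\<lambda>\<eta>. ennreal \<bar>poly Pk ((norm (transpose T *v \<eta>))\<^sup>2)\<bar>"
  let ?I = "ennreal (\<integral>t. (poly Pk t)\<^sup>2 * f t \<partial>lborel)"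
  let ?\<phi> = "radial_part T s Uh"
  have Uh: "Uh \<in> borel_measurable borel"
    using assms(4) by (auto simp: has_fourier_transform_def dest: borel_measurable_integrable)
  have A: "?A \<noteq> 0" "?A \<noteq> \<infinity>"
    using sphere_area_pos[of "CARD('n)"] by simp_all
  \<comment> \<open>Outside a null set of directions, \<open>c\<close> is the value of the
    polynomial at \<eta>, and \<open>cmod\<close> turns it into the absolute value in
    \<open>?p\<close>.\<close>
  have "(\<integral>\<^sup>+\<eta>. radial_part T s (\<lambda>\<omega>. Uh \<omega> - Ukh \<omega>) \<eta> \<partial>?S) = (\<integral>\<^sup>+\<eta>. ?p \<eta> * ?\<phi> \<eta> \<partial>?S)"
    using assms(12)
    by (intro nn_integral_cong_AE) (auto elim!: eventually_mono dest: radial_part_cmult[OF Uh])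
  then have "(s_norm T s (\<lambda>\<omega>. Uh \<omega> - Ukh \<omega>))\<^sup>2 = (\<integral>\<^sup>+\<eta>. ?p \<eta> * ?\<phi> \<eta> \<partial>?S)\<^sup>2 / ?A\<^sup>2"
    by (simp add: s_norm_def divide_ennreal_def power_mult_distrib ennreal_inverse_power)
  also have "\<dots> \<le> ((\<integral>\<^sup>+\<eta>. (?p \<eta>)\<^sup>2 \<partial>?S) * (\<integral>\<^sup>+\<eta>. (?\<phi> \<eta>)\<^sup>2 \<partial>?S)) / ?A\<^sup>2"
    by (intro divide_right_mono_ennreal Cauchy_Schwarz_nn_integral borel_measurable_surface_measure
        borel_measurable_radial_part Uh) measurable
  also have "\<dots> = (?A * ?I * (\<integral>\<^sup>+\<eta>. (?\<phi> \<eta>)\<^sup>2 \<partial>?S)) / ?A\<^sup>2"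
    by (simp only: nn_integral_poly_sphere_density[OF assms(13)])
  \<comment> \<open>One of the two factors \<open>?A\<close> in the denominator cancels, which in
    the extended numbers requires \<open>?A\<close> to be neither 0 nor infinite; the other one
    normalizes the triple norm.\<close>
  also have "\<dots> = ?I * ((\<integral>\<^sup>+\<eta>. (?\<phi> \<eta>)\<^sup>2 \<partial>?S) / ?A)"
    using divide_mult_eq[OF A, of "?I * (\<integral>\<^sup>+\<eta>. (?\<phi> \<eta>)\<^sup>2 \<partial>?S)" ?A]
    by (simp only: power2_eq_square ennreal_times_divide ac_simps)
  also have "\<dots> = ?I * (triple_norm T s Uh)\<^sup>2"
    by (simp add: triple_norm_def)
  finally show ?thesis .
qed

end
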